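(* (SMDCT VI) Let $n,N$ be positive integers. For all $k,k'\in D_N^+$, $$\sum_{s\in F_N^{\mathrm{VI},+}}\widetilde{\varepsilon}_s H_s^{-1}\cos_k^+(s)\cos_{k'}^+(s)=\frac{H_k}{d_k}\left(\frac{2N-1}{4}\right)^n\delta_{kk'}.$$ Consequently any function $f:F_N^{\mathrm{VI},+}\to\mathbb{R}$ can be expanded, for all $s\in F_N^{\mathrm{VI},+}$, as $$f(s)=\sum_{k\in D_N^+}A_k\cos^+_k(s)\quad\text{with}\quad A_k=\frac{d_k}{H_k}\left(\frac{4}{2N-1}\right)^n\sum_{s\in F_N^{\mathrm{VI},+}}\widetilde{\varepsilon}_s H_s^{-1}f(s)\cos_k^+(s).$$
   Context: For $\lambda,x\in\mathbb{R}^n$, the symmetric cosine function is $\cos^+_\lambda(x)=\sum_{\sigma\in S_n}\prod_{i=1}^n\cos(\pi\lambda_{\sigma(i)}x_i)$. For $y\in\mathbb{R}^n$, $H_y=\#\{\sigma\in S_n : \sigma(y)=y\}$ is the order of the stabilizer of $y$, where $\sigma(y)=(y_{\sigma(1)},\dots,y_{\sigma(n)})$. For fixed $N$, put $c_r=\frac12$ if $r=0$ or $r=N$, and $c_r=1$ otherwise. Let $D_N=\{(k_1,\dots,k_n)\in\mathbb{Z}^n : 0\le k_i\le N-1,\ i=1,\dots,n\}$ and $D_N^+=\{k\in D_N : k_1\ge k_2\ge\dots\ge k_n\}$. For $k\in D_N$, $d_k=c_{k_1}\cdots c_{k_n}$. The grid is $F_N^{\mathrm{VI},+}=\left\{\left(\frac{2(r_1+\frac12)}{2N-1},\dots,\frac{2(r_n+\frac12)}{2N-1}\right)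 : (r_1,\dots,r_n)\in D_N^+\right\}$, and for $s=\left(\frac{2(r_1+\frac12)}{2N-1},\dots,\frac{2(r_n+\frac12)}{2N-1}\right)$ in it, $\widetilde{\varepsilon}_s=c_{r_1+1}\cdots c_{r_n+1}$. *)

theory Defs
  imports Complex_Main "HOL-Library.FuncSet" "HOL-Combinatorics.Permutations"
begin

text \<open>
  A vector of length \<open>n\<close> is a function on \<open>{1..n}\<close>. Index vectors and grid points are taken
  extensional (they are \<open>undefined\<close> outside \<open>{1..n}\<close>), so that equality of functions
  is equality of vectors.
\<close>

definition cos_plus :: "nat \<Rightarrow> (nat \<Rightarrow> real) \<Rightarrow> (nat \<Rightarrow> real) \<Rightarrow> real" where
  "cos_plus n l x = (\<Sum>\<sigma> | \<sigma> permutes {1..n}. \<Prod>i=1..n. cos (pi * l (\<sigma> i) * x i))"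

text \<open>
  As \<open>\<sigma>\<close> fixes everything outside \<open>{1..n}\<close>, the equation \<open>y \<circ> \<sigma> = y\<close> only constrains
  the entries with index in \<open>{1..n}\<close>.
\<close>

definition stab_order :: "nat \<Rightarrow> (nat \<Rightarrow> 'a) \<Rightarrow> nat" where
  "stab_order n y = card {\<sigma>. \<sigma> permutes {1..n} \<and> y \<circ> \<sigma> = y}"

definition c_weight :: "nat \<Rightarrow> int \<Rightarrow> real" where
  "c_weight N r = (if r = 0 \<or> r = int N then 1 / 2 else 1)"

definition D_set :: "nat \<Rightarrow> nat \<Rightarrow> (nat \<Rightarrow> int) set" where
  "D_set n N = {1..n} \<rightarrow>\<^sub>E {0..int N - 1}"

definition D_plus :: "nat \<Rightarrow> nat \<Rightarrow> (nat \<Rightarrow> int) set" where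
  "D_plus n N = {k \<in> D_set n N. antimono_on {1..n} k}"

definition d_weight :: "nat \<Rightarrow> nat \<Rightarrow> (nat \<Rightarrow> int) \<Rightarrow> real" where
  "d_weight n N k = (\<Prod>i=1..n. c_weight N (k i))"

definition grid_point :: "nat \<Rightarrow> nat \<Rightarrow> (nat \<Rightarrow> int) \<Rightarrow> (nat \<Rightarrow> real)" where
  "grid_point n N r =
     (\<lambda>i\<in>{1..n}. 2 * (real_of_int (r i) + 1 / 2) / (2 * real N - 1))"

definition F_plus :: "nat \<Rightarrow> nat \<Rightarrow> (nat \<Rightarrow> real) set" where
  "F_plus n N = grid_point n N ` D_plus n N"

text \<open>The label \<open>r\<close> is unique because \<open>grid_point n N\<close> is injective on \<open>D_plus n N\<close>.\<close>

definition grid_label :: "nat \<Rightarrow> nat \<Rightarrow> (nat \<Rightarrow> real) \<Rightarrow> (nat \<Rightarrow> int)" where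
  "grid_label n N s = (THE r. r \<in> D_plus n N \<and> s = grid_point n N r)"

definition eps_weight :: "nat \<Rightarrow> nat \<Rightarrow> (nat \<Rightarrow> real) \<Rightarrow> real" where
  "eps_weight n N s = (\<Prod>i=1..n. c_weight N (grid_label n N s i + 1))"

definition smdct_coeff ::
    "nat \<Rightarrow> nat \<Rightarrow> ((nat \<Rightarrow> real) \<Rightarrow> real) \<Rightarrow> (nat \<Rightarrow> int) \<Rightarrow> real" where
  "smdct_coeff n N f k =
     d_weight n N k / real (stab_order n k) * (4 / (2 * real N - 1)) ^ n *
     (\<Sum>s\<in>F_plus n N. eps_weight n N s * inverse (real (stab_order n s)) * f s *
        cos_plus n (\<lambda>i. real_of_int (k i)) s)"

end

theory Submission
  imports Defs
begin

text \<open>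
  Put \<open>M = 2N - 1\<close>. In one variable the transform has the matrix \<open>cos (\<pi>k(2r + 1) / M)\<close> with
  \<open>0 \<le> k, r \<le> N - 1\<close>. Reversing the grid by \<open>r = N - 1 - q\<close> turns the entry into
  \<open>(-1)\<^sup>k cos (2\<pi>kq / M)\<close> and the weight \<open>c\<^bsub>r+1\<^esub>\<close> into \<open>c\<^bsub>q\<^esub>\<close>. The matrix
  \<open>cos (2\<pi>kq / M)\<close> is symmetric in \<open>k\<close> and \<open>q\<close>, so its orthogonality relation
  (\<open>cos_orthogonality\<close>, a consequence of the closed form of the Dirichlet kernel) yields both the
  orthogonality of the functions indexed by \<open>k\<close>, summed over the grid
  (\<open>dct_orthogonality_rows\<close>), and the dual relation, summed over \<open>k\<close>
  (\<open>dct_orthogonality_columns\<close>).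

  Passing to \<open>n\<close> variables uses nothing about cosines. Every tuple is a rearrangement of exactly
  one decreasing tuple \<open>b\<close>, and each rearrangement of \<open>b\<close> is produced by \<open>H\<^bsub>b\<^esub>\<close> permutations;
  hence summing a symmetric function over decreasing tuples with weight \<open>n! / H\<^bsub>b\<^esub>\<close> is the same
  as summing it over all tuples (\<open>sum_dec_tuples_over_stab_order\<close>). The sum over all tuples of
  a product of two symmetrized kernels factors into one-dimensional sums, and the surviving terms
  are counted by a stabilizer (\<open>symmetrized_orthogonality\<close>).

  This lemma is applied twice. With the rows it gives the first claim. With the columns, it gives
  the dual relation for the symmetric cosine functions, since transposing the kernel exchanges the
  two arguments of its symmetrization (\<open>sym_kernel_flip\<close>); inserting the definition of the
  coefficients into the expansion and exchanging the two sums then leaves \<open>f s\<close>.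
\<close>

section \<open>Permutations of tuples\<close>

declare One_nat_def [simp del]

definition dec_tuples :: "nat \<Rightarrow> 'a::linorder set \<Rightarrow> (nat \<Rightarrow> 'a) set" where
  "dec_tuples n A = {k \<in> {1..n} \<rightarrow>\<^sub>E A. antimono_on {1..n} k}"

lemma finite_dec_tuples: "finite A \<Longrightarrow> finite (dec_tuples n A)"
  unfolding dec_tuples_def by (rule finite_subset[of _ "{1..n} \<rightarrow>\<^sub>E A"]) (auto intro: finite_PiE)

lemma compose_permutes_PiE:
  assumes "b \<in> I \<rightarrow>\<^sub>E A" "\<sigma> permutes I"
  shows "b \<circ> \<sigma> \<in> I \<rightarrow>\<^sub>E A"
  using assms by (auto simp: PiE_iff extensional_def permutes_in_image permutes_not_in)

lemma mset_map_upt: "mset (map f [1..<Suc n]) = image_mset f (mset_set {1..n})"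
  by (metis mset_map mset_upt atLeastLessThanSuc_atLeastAtMost)

lemma sorted_rev_map_antimono_on:
  assumes "antimono_on {1..n} k"
  shows "sorted (rev (map k [1..<Suc n]))"
  unfolding sorted_wrt_rev sorted_wrt_map
  by (rule sorted_wrt_mono_rel[OF _ sorted_wrt_upt])
    (use assms in \<open>auto simp: monotone_on_def simp del: upt_Suc\<close>)

text \<open>The reversed lists of entries are sorted and have the same multiset, so they coincide.\<close>

lemma dec_tuple_unique_rearrangement:
  assumes k: "k \<in> dec_tuples n A" and k': "k' \<in> dec_tuples n B"
    and \<sigma>: "\<sigma> permutes {1..n}" and eq: "k \<circ> \<sigma> = k'"
  shows "k = k'"
proof -
  have "image_mset k' (mset_set {1..n}) = image_mset k (image_mset \<sigma> (mset_set {1..n}))"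
    by (simp add: eq[symmetric] multiset.map_comp)
  also have "image_mset \<sigma> (mset_set {1..n}) = mset_set {1..n}"
    using permutes_image[OF \<sigma>] permutes_inj_on[OF \<sigma>] by (simp add: image_mset_mset_set)
  finally have "mset (rev (map k' [1..<Suc n])) = mset (rev (map k [1..<Suc n]))"
    by (simp only: mset_rev mset_map_upt)
  moreover have "sorted (rev (map k [1..<Suc n]))" "sorted (rev (map k' [1..<Suc n]))"
    using k k' by (auto simp only: dec_tuples_def mem_Collect_eq intro: sorted_rev_map_antimono_on)
  ultimately have "rev (map k' [1..<Suc n]) = rev (map k [1..<Suc n])"
    by (metis properties_for_sort)
  hence "k i = k' i" if "i \<in> {1..n}" for i
    using that by (simp del: upt_Suc)
  moreover have "k \<in> {1..n} \<rightarrow>\<^sub>E A" "k' \<in> {1..n} \<rightarrow>\<^sub>E B"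
    using k k' by (simp_all add: dec_tuples_def)
  ultimately show ?thesis by (metis PiE_iff extensionalityI)
qed

lemma ex_dec_rearrangement:
  fixes A :: "'a::linorder set"
  assumes x: "x \<in> {1..n} \<rightarrow>\<^sub>E A"
  shows "\<exists>b\<in>dec_tuples n A. \<exists>\<sigma>. \<sigma> permutes {1..n} \<and> b \<circ> \<sigma> = x"
proof -
  define L where "L = rev (sort (map x [1..<Suc n]))"
  define y where "y = (\<lambda>i. L ! (i - 1))"
  have len: "length L = n" by (simp add: L_def)
  have mono: "antimono_on {1..n} y"
    using sorted_rev_nth_mono[of L] len
    by (auto simp: monotone_on_def y_def L_def)
  have "map y [1..<Suc n] = L"
    by (rule nth_equalityI) (auto simp: len y_def simp del: upt_Suc)
  hence "image_mset y (mset_set {1..n}) = image_mset x (mset_set {1..n})"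
    by (simp only: mset_map_upt[symmetric]) (simp add: L_def del: upt_Suc)
  then obtain p where p: "p permutes {1..n}" "\<forall>i\<in>{1..n}. x i = y (p i)"
    by (metis finite_atLeastAtMost image_mset_eq_implies_permutes)
  define b where "b = x \<circ> inv p"
  have ip: "inv p permutes {1..n}" using p by (simp add: permutes_inv)
  have "b i = y i" if "i \<in> {1..n}" for i
    using p that permutes_in_image[OF ip] permutes_inverses[OF p(1)] by (metis b_def comp_apply)
  hence "antimono_on {1..n} b" using mono by (simp add: monotone_on_def)
  moreover have "b \<in> {1..n} \<rightarrow>\<^sub>E A" unfolding b_def by (rule compose_permutes_PiE[OF x ip])
  moreover have "b \<circ> p = x" by (simp add: b_def o_assoc[symmetric] permutes_inv_o[OF p(1)])
  ultimately show ?thesis using p(1) by (auto simp: dec_tuples_def)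
qed

text \<open>The permutations in question form a coset \<open>{\<rho> \<circ> \<tau>}\<close> of the stabilizer of \<open>b\<close>.\<close>

lemma card_permutes_coset:
  assumes \<tau>: "\<tau> permutes {1..n}"
  shows "card {\<sigma>. \<sigma> permutes {1..n} \<and> b \<circ> \<sigma> = b \<circ> \<tau>} = stab_order n b"
proof -
  have "bij_betw (\<lambda>\<rho>. \<rho> \<circ> \<tau>) {\<rho>. \<rho> permutes {1..n} \<and> b \<circ> \<rho> = b}
     {\<sigma>. \<sigma> permutes {1..n} \<and> b \<circ> \<sigma> = b \<circ> \<tau>}"
  proof (rule bij_betwI[where g = "\<lambda>\<sigma>. \<sigma> \<circ> inv \<tau>"])
    have "b \<circ> (\<sigma> \<circ> inv \<tau>) = b" if "b \<circ> \<sigma> = b \<circ> \<tau>" for \<sigma>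
      using that by (metis comp_assoc comp_id permutes_inv_o(1)[OF \<tau>])
    thus "(\<lambda>\<sigma>. \<sigma> \<circ> inv \<tau>) \<in> {\<sigma>. \<sigma> permutes {1..n} \<and> b \<circ> \<sigma> = b \<circ> \<tau>}
        \<rightarrow> {\<rho>. \<rho> permutes {1..n} \<and> b \<circ> \<rho> = b}"
      by (auto intro: permutes_compose permutes_inv[OF \<tau>])
  qed (auto simp: comp_assoc permutes_inv_o[OF \<tau>] intro: permutes_compose[OF \<tau>],
    metis comp_assoc)
  from bij_betw_same_card[OF this] show ?thesis by (simp add: stab_order_def)
qed

lemma stab_order_pos: "stab_order n b > 0"
proof -
  have "id \<in> {\<sigma>. \<sigma> permutes {1..n} \<and> b \<circ> \<sigma> = b}" by simp
  moreover have "finite {\<sigma>. \<sigma> permutes {1..n} \<and> b \<circ> \<sigma> = b}"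
    by (rule finite_subset[OF _ finite_permutations[of "{1..n}"]]) auto
  ultimately show ?thesis unfolding stab_order_def by (metis card_gt_0_iff empty_iff)
qed

text \<open>
  Orbit counting: each tuple \<open>x\<close> equals \<open>b \<circ> \<sigma>\<close> for one decreasing \<open>b\<close> and a coset of
  permutations \<open>\<sigma>\<close>, so the weights \<open>1 / H\<^bsub>b\<^esub>\<close> of all pairs \<open>(b, \<sigma>)\<close> over \<open>x\<close> add up to 1.
  Inserting this 1 into the sum over \<open>x\<close> and exchanging sums gives the formula.
\<close>

lemma sum_dec_tuples_over_stab_order:
  fixes A :: "'a::linorder set" and g :: "(nat \<Rightarrow> 'a) \<Rightarrow> real"
  assumes fin: "finite A"
    and inv: "\<And>b \<sigma>. b \<in> dec_tuples n A \<Longrightarrow> \<sigma> permutes {1..n} \<Longrightarrow> g (b \<circ> \<sigma>) = g b"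
  shows "fact n * (\<Sum>b\<in>dec_tuples n A. g b / real (stab_order n b)) = (\<Sum>x\<in>{1..n} \<rightarrow>\<^sub>E A. g x)"
proof -
  let ?P = "{\<sigma>. \<sigma> permutes {1..n}}" and ?X = "{1..n} \<rightarrow>\<^sub>E A" and ?D = "dec_tuples n A"
  have finP: "finite ?P" by (simp add: finite_permutations)
  have finX: "finite ?X" using fin by (simp add: finite_PiE)
  have DX: "b \<in> ?X" if "b \<in> ?D" for b using that by (simp add: dec_tuples_def)
  have one: "(\<Sum>b\<in>?D. \<Sum>\<sigma>\<in>?P. if b \<circ> \<sigma> = x then 1 / real (stab_order n b) else 0) = 1"
    if x: "x \<in> ?X" for x
  proof -
    obtain b0 \<tau> where b0: "b0 \<in> ?D" and \<tau>: "\<tau> permutes {1..n}" and bx: "b0 \<circ> \<tau> = x"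
      using ex_dec_rearrangement[OF x] by blast
    have "(\<Sum>\<sigma>\<in>?P. if b \<circ> \<sigma> = x then 1 / real (stab_order n b) else 0) = (if b = b0 then 1 else 0)"
      if b: "b \<in> ?D" for b
    proof (cases "b = b0")
      case True
      have "(\<Sum>\<sigma>\<in>?P. if b \<circ> \<sigma> = x then 1 / real (stab_order n b) else 0)
          = real (card {\<sigma>. \<sigma> permutes {1..n} \<and> b \<circ> \<sigma> = b \<circ> \<tau>}) / real (stab_order n b)"
        using finP True bx by (simp add: sum.If_cases Int_def)
      thus ?thesis using True stab_order_pos[of n b] by (simp add: card_permutes_coset[OF \<tau>])
    next
      case False
      have "b \<circ> \<sigma> \<noteq> x" if \<sigma>: "\<sigma> permutes {1..n}" for \<sigma>
      proof
        assume "b \<circ> \<sigma> = x"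
        hence "b \<circ> (\<sigma> \<circ> inv \<tau>) = b0"
          using bx by (metis comp_assoc comp_id permutes_inv_o(1)[OF \<tau>])
        moreover have "\<sigma> \<circ> inv \<tau> permutes {1..n}"
          by (simp add: permutes_compose permutes_inv \<sigma> \<tau>)
        ultimately show False using dec_tuple_unique_rearrangement[OF b b0] False by blast
      qed
      thus ?thesis using False by simp
    qed
    thus ?thesis using b0 finite_dec_tuples[OF fin] by simp
  qed
  have "(\<Sum>x\<in>?X. g x) = (\<Sum>x\<in>?X. \<Sum>b\<in>?D. \<Sum>\<sigma>\<in>?P. if b \<circ> \<sigma> = x then g x / real (stab_order n b) else 0)"
  proof (rule sum.cong[OF refl])
    fix x assume x: "x \<in> ?X"
    have "g x = g x * (\<Sum>b\<in>?D. \<Sum>\<sigma>\<in>?P. if b \<circ> \<sigma> = x then 1 / real (stab_order n b) else 0)"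
      by (simp only: one[OF x] mult_1_right)
    thus "g x = (\<Sum>b\<in>?D. \<Sum>\<sigma>\<in>?P. if b \<circ> \<sigma> = x then g x / real (stab_order n b) else 0)"
      by (simp add: sum_distrib_left if_distrib cong: if_cong)
  qed
  also have "\<dots> = (\<Sum>b\<in>?D. \<Sum>x\<in>?X. \<Sum>\<sigma>\<in>?P. if b \<circ> \<sigma> = x then g x / real (stab_order n b) else 0)"
    by (rule sum.swap)
  also have "\<dots> = (\<Sum>b\<in>?D. \<Sum>\<sigma>\<in>?P. \<Sum>x\<in>?X. if b \<circ> \<sigma> = x then g x / real (stab_order n b) else 0)"
    by (intro sum.cong refl sum.swap)
  also have "\<dots> = (\<Sum>b\<in>?D. \<Sum>\<sigma>\<in>?P. g b / real (stab_order n b))"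
  proof (intro sum.cong refl)
    fix b \<sigma> assume b: "b \<in> ?D" and "\<sigma> \<in> ?P"
    hence \<sigma>: "\<sigma> permutes {1..n}" by simp
    show "(\<Sum>x\<in>?X. if b \<circ> \<sigma> = x then g x / real (stab_order n b) else 0) = g b / real (stab_order n b)"
      using finX compose_permutes_PiE[OF DX[OF b] \<sigma>] by (simp add: inv[OF b \<sigma>])
  qed
  also have "\<dots> = fact n * (\<Sum>b\<in>?D. g b / real (stab_order n b))"
    by (simp add: card_permutations[of "{1..n}" n] sum_distrib_left)
  finally show ?thesis ..
qed

section \<open>Symmetrized orthogonality\<close>

definition sym_kernel :: "nat \<Rightarrow> ('a \<Rightarrow> 'b \<Rightarrow> real) \<Rightarrow> (nat \<Rightarrow> 'a) \<Rightarrow> (nat \<Rightarrow> 'b) \<Rightarrow> real" where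
  "sym_kernel n \<phi> a b = (\<Sum>\<sigma> | \<sigma> permutes {1..n}. \<Prod>i=1..n. \<phi> (a (\<sigma> i)) (b i))"

lemma prod_compose_permutes:
  assumes "\<tau> permutes I"
  shows "(\<Prod>i\<in>I. f (\<tau> i)) = (\<Prod>i\<in>I. f i)"
  using prod.permute[OF assms, of f] by (simp add: o_def)

lemma sym_kernel_flip: "sym_kernel n \<phi> a b = sym_kernel n (\<lambda>y x. \<phi> x y) b a"
proof -
  have "sym_kernel n \<phi> a b
      = (\<Sum>\<sigma> | \<sigma> permutes {1..n}. \<Prod>i=1..n. \<phi> (a (inv \<sigma> i)) (b i))"
    unfolding sym_kernel_def by (subst sum_permutations_inverse) (simp add: o_def)
  also have "\<dots> = (\<Sum>\<sigma> | \<sigma> permutes {1..n}. \<Prod>i=1..n. \<phi> (a i) (b (\<sigma> i)))"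
  proof (rule sum.cong[OF refl])
    fix \<sigma> assume "\<sigma> \<in> {\<sigma>. \<sigma> permutes {1..n}}"
    hence \<sigma>: "\<sigma> permutes {1..n}" by simp
    show "(\<Prod>i=1..n. \<phi> (a (inv \<sigma> i)) (b i)) = (\<Prod>i=1..n. \<phi> (a i) (b (\<sigma> i)))"
      using prod_compose_permutes[OF \<sigma>, of "\<lambda>i. \<phi> (a (inv \<sigma> i)) (b i)"]
      by (simp add: permutes_inverses[OF \<sigma>])
  qed
  finally show ?thesis by (simp add: sym_kernel_def)
qed

lemma sym_kernel_permute_left:
  assumes \<tau>: "\<tau> permutes {1..n}"
  shows "sym_kernel n \<phi> (a \<circ> \<tau>) b = sym_kernel n \<phi> a b"
  unfolding sym_kernel_def
  by (subst (2) setum_permutations_compose_left[OF \<tau>]) simp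

lemma sym_kernel_permute_right:
  assumes "\<tau> permutes {1..n}"
  shows "sym_kernel n \<phi> a (b \<circ> \<tau>) = sym_kernel n \<phi> a b"
  by (metis sym_kernel_flip sym_kernel_permute_left[OF assms])

text \<open>
  By the orbit formula the left-hand side is \<open>1 / n!\<close> times a sum over all tuples. Expanding both
  symmetrizations over permutations \<open>\<sigma>\<close> and \<open>\<tau>\<close>, the sum over tuples becomes a product of
  one-dimensional sums, which is nonzero only if \<open>a \<circ> \<sigma> = a' \<circ> \<tau>\<close>. For decreasing \<open>a\<close> and
  \<open>a'\<close> this forces \<open>a = a'\<close>, and then for each of the \<open>n!\<close> choices of \<open>\<tau>\<close> it holds for
  \<open>H\<^bsub>a\<^esub>\<close> values of \<open>\<sigma>\<close>.
\<close>

lemma symmetrized_orthogonality: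
  fixes \<phi> :: "'a::linorder \<Rightarrow> 'b::linorder \<Rightarrow> real"
  assumes fin: "finite B"
    and orth: "\<And>x y. x \<in> A \<Longrightarrow> y \<in> A \<Longrightarrow>
      (\<Sum>b\<in>B. w b * \<phi> x b * \<phi> y b) = (if x = y then C / v x else 0)"
    and a: "a \<in> dec_tuples n A" and a': "a' \<in> dec_tuples n A"
  shows "(\<Sum>b\<in>dec_tuples n B. (\<Prod>i=1..n. w (b i)) * inverse (real (stab_order n b)) *
            sym_kernel n \<phi> a b * sym_kernel n \<phi> a' b)
       = (if a = a' then real (stab_order n a) / (\<Prod>i=1..n. v (a i)) * C ^ n else 0)"
    (is "?S = _")
proof -
  let ?P = "{\<sigma>. \<sigma> permutes {1..n}}"
  let ?X = "{1..n} \<rightarrow>\<^sub>E B"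
  let ?K = "C ^ n / (\<Prod>i=1..n. v (a i))"
  have finP: "finite ?P" by (simp add: finite_permutations)
  have aX: "a \<in> {1..n} \<rightarrow>\<^sub>E A" and aX': "a' \<in> {1..n} \<rightarrow>\<^sub>E A"
    using a a' by (auto simp: dec_tuples_def)
  define g where "g = (\<lambda>b. (\<Prod>i=1..n. w (b i)) * sym_kernel n \<phi> a b * sym_kernel n \<phi> a' b)"
  have "?S = (\<Sum>b\<in>dec_tuples n B. g b / real (stab_order n b))"
    by (simp add: g_def field_simps)
  moreover have "g (b \<circ> \<sigma>) = g b" if "\<sigma> permutes {1..n}" for b \<sigma>
    using that prod_compose_permutes[OF that, of "\<lambda>i. w (b i)"]
    by (simp only: g_def sym_kernel_permute_right o_apply)
  ultimately have "fact n * ?S = (\<Sum>x\<in>?X. g x)"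
    using sum_dec_tuples_over_stab_order[OF fin] by metis
  also have "\<dots> = (\<Sum>x\<in>?X. \<Sum>\<tau>\<in>?P. \<Sum>\<sigma>\<in>?P. \<Prod>i=1..n. w (x i) * \<phi> (a (\<sigma> i)) (x i) * \<phi> (a' (\<tau> i)) (x i))"
    by (simp add: g_def sym_kernel_def sum_distrib_left sum_distrib_right prod.distrib)
  also have "\<dots> = (\<Sum>\<tau>\<in>?P. \<Sum>x\<in>?X. \<Sum>\<sigma>\<in>?P. \<Prod>i=1..n. w (x i) * \<phi> (a (\<sigma> i)) (x i) * \<phi> (a' (\<tau> i)) (x i))"
    by (rule sum.swap)
  also have "\<dots> = (\<Sum>\<tau>\<in>?P. \<Sum>\<sigma>\<in>?P. \<Sum>x\<in>?X. \<Prod>i=1..n. w (x i) * \<phi> (a (\<sigma> i)) (x i) * \<phi> (a' (\<tau> i)) (x i))"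
    by (intro sum.cong refl sum.swap)
  also have "\<dots> = (\<Sum>\<tau>\<in>?P. \<Sum>\<sigma>\<in>?P. \<Prod>i=1..n. \<Sum>b\<in>B. w b * \<phi> (a (\<sigma> i)) b * \<phi> (a' (\<tau> i)) b)"
    using fin by (subst prod_sum_PiE) auto
  also have "\<dots> = (\<Sum>\<tau>\<in>?P. \<Sum>\<sigma>\<in>?P. if a \<circ> \<sigma> = a' \<circ> \<tau> then ?K else 0)"
  proof (intro sum.cong refl)
    fix \<sigma> \<tau> assume "\<tau> \<in> ?P" "\<sigma> \<in> ?P"
    hence \<sigma>: "\<sigma> permutes {1..n}" and \<tau>: "\<tau> permutes {1..n}" by auto
    have mem: "a \<circ> \<sigma> \<in> {1..n} \<rightarrow>\<^sub>E A" "a' \<circ> \<tau> \<in> {1..n} \<rightarrow>\<^sub>E A"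
      using compose_permutes_PiE aX aX' \<sigma> \<tau> by blast+
    have "(\<Prod>i=1..n. \<Sum>b\<in>B. w b * \<phi> (a (\<sigma> i)) b * \<phi> (a' (\<tau> i)) b)
        = (\<Prod>i=1..n. if a (\<sigma> i) = a' (\<tau> i) then C / v (a (\<sigma> i)) else 0)"
      using mem by (intro prod.cong refl orth) (auto simp: PiE_iff)
    also have "\<dots> = (if a \<circ> \<sigma> = a' \<circ> \<tau> then ?K else 0)"
    proof (cases "a \<circ> \<sigma> = a' \<circ> \<tau>")
      case True
      hence "a (\<sigma> i) = a' (\<tau> i)" for i by (metis comp_apply)
      hence "(\<Prod>i=1..n. if a (\<sigma> i) = a' (\<tau> i) then C / v (a (\<sigma> i)) else 0)
          = (\<Prod>i=1..n. C / v (a (\<sigma> i)))" by simp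
      also have "\<dots> = (\<Prod>i=1..n. C / v (a i))"
        by (rule prod_compose_permutes[OF \<sigma>])
      finally show ?thesis using True by (simp add: prod_dividef)
    next
      case False
      then obtain i where i: "i \<in> {1..n}" "a (\<sigma> i) \<noteq> a' (\<tau> i)"
        by (metis PiE_ext[OF mem] o_apply)
      have "(\<Prod>i=1..n. if a (\<sigma> i) = a' (\<tau> i) then C / v (a (\<sigma> i)) else 0) = 0"
        by (rule prod_zero) (use i in auto)
      thus ?thesis using False by simp
    qed
    finally show "(\<Prod>i=1..n. \<Sum>b\<in>B. w b * \<phi> (a (\<sigma> i)) b * \<phi> (a' (\<tau> i)) b)
        = (if a \<circ> \<sigma> = a' \<circ> \<tau> then ?K else 0)" .
  qed
  also have "\<dots> = (\<Sum>\<tau>\<in>?P. if a = a' then real (stab_order n a) * ?K else 0)"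
  proof (rule sum.cong[OF refl])
    fix \<tau> assume "\<tau> \<in> ?P"
    hence \<tau>: "\<tau> permutes {1..n}" by simp
    show "(\<Sum>\<sigma>\<in>?P. if a \<circ> \<sigma> = a' \<circ> \<tau> then ?K else 0) = (if a = a' then real (stab_order n a) * ?K else 0)"
    proof (cases "a = a'")
      case True
      have "(\<Sum>\<sigma>\<in>?P. if a \<circ> \<sigma> = a' \<circ> \<tau> then ?K else 0)
          = real (card {\<sigma>. \<sigma> permutes {1..n} \<and> a \<circ> \<sigma> = a \<circ> \<tau>}) * ?K"
        using finP True by (simp add: sum.If_cases Int_def)
      thus ?thesis using True by (simp add: card_permutes_coset[OF \<tau>])
    next
      case False
      have "a \<circ> \<sigma> \<noteq> a' \<circ> \<tau>" if \<sigma>: "\<sigma> permutes {1..n}" for \<sigma>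
      proof
        assume "a \<circ> \<sigma> = a' \<circ> \<tau>"
        hence "a \<circ> (\<sigma> \<circ> inv \<tau>) = a'"
          by (metis comp_assoc comp_id permutes_inv_o(1)[OF \<tau>])
        moreover have "\<sigma> \<circ> inv \<tau> permutes {1..n}"
          by (simp add: permutes_compose permutes_inv \<sigma> \<tau>)
        ultimately show False using dec_tuple_unique_rearrangement[OF a a'] False by blast
      qed
      thus ?thesis using False by simp
    qed
  qed
  also have "\<dots> = fact n * (if a = a' then real (stab_order n a) * ?K else 0)"
    by (simp add: card_permutations[of "{1..n}" n])
  finally have "?S = (if a = a' then real (stab_order n a) * ?K else 0)"
    by (simp only: mult_cancel_left fact_nonzero) simp
  thus ?thesis by simp
qed

section \<open>The one-dimensional transform\<close>

lemma dirichlet_kernel: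
  "sin (x / 2) * ((\<Sum>q=0..<N. 2 * cos (real q * x)) - 1) = sin ((real N - 1 / 2) * x)"
proof (induction N)
  case 0
  have "- (x / 2) = (real 0 - 1 / 2) * x" by simp
  thus ?case by (metis (no_types, lifting) atLeastLessThan0 diff_0 mult_minus1_right sin_minus sum.empty)
next
  case (Suc N)
  \<comment> \<open>the sum telescopes, because \<open>2 sin (x / 2) cos (N x)\<close> is a difference of sines\<close>
  have "sin ((real N - 1 / 2) * x) + sin (x / 2) * (2 * cos (real N * x)) = sin ((real (Suc N) - 1 / 2) * x)"
  proof -
    have e: "(real (Suc N) - 1 / 2) * x = real N * x + x / 2" "(real N - 1 / 2) * x = real N * x - x / 2"
      by (auto simp: algebra_simps)
    show ?thesis unfolding e sin_add sin_diff by simp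
  qed
  thus ?case using Suc.IH by (simp add: algebra_simps)
qed

text \<open>
  As \<open>M = 2N - 1\<close> is odd, \<open>q \<mapsto> -q\<close> folds the residues modulo \<open>M\<close> onto \<open>{0..N - 1}\<close> and only 0
  is fixed; the weight halves that term, and the sum is half of a full sum of \<open>M\<close>-th roots of
  unity. The vanishing is read off from the Dirichlet kernel at \<open>x = 2\<pi>j / M\<close>: its right-hand
  side is \<open>sin (\<pi>j) = 0\<close>, while \<open>sin (x / 2)\<close> is zero only if \<open>M\<close> divides \<open>j\<close>.
\<close>

lemma sum_c_weight_cos:
  assumes N: "N \<ge> 1" and j: "\<bar>j\<bar> < 2 * int N - 1"
  shows "(\<Sum>q=0..int N - 1. c_weight N q * cos (2 * pi * real_of_int j * real_of_int q / (2 * real N - 1)))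
       = (if j = 0 then (2 * real N - 1) / 2 else 0)"
proof -
  define x where "x = 2 * pi * real_of_int j / (2 * real N - 1)"
  let ?T = "\<Sum>q=0..<N. cos (real q * x)"
  have M: "2 * real N - 1 > 0" using N by simp
  have "{0..int N - 1} = int ` {0..<N}" by (auto simp: image_int_atLeastLessThan)
  hence "(\<Sum>q=0..int N - 1. c_weight N q * cos (2 * pi * real_of_int j * real_of_int q / (2 * real N - 1)))
      = (\<Sum>q=0..<N. c_weight N (int q) * cos (real q * x))"
    by (simp add: sum.reindex x_def mult_ac)
  also have "\<dots> = (\<Sum>q=0..<N. cos (real q * x) - (if q = 0 then 1 / 2 else 0))"
    by (rule sum.cong) (auto simp: c_weight_def)
  also have "\<dots> = ?T - 1 / 2" using N by (simp add: sum_subtractf)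
  also have "\<dots> = (if j = 0 then (2 * real N - 1) / 2 else 0)"
  proof (cases "j = 0")
    case True
    thus ?thesis by (simp add: x_def)
  next
    case False
    have "(real N - 1 / 2) * x = pi * real_of_int j"
      using M by (simp add: x_def field_simps)
    hence "sin (x / 2) * (2 * ?T - 1) = 0"
      using dirichlet_kernel[of x N] by (simp add: sum_distrib_left)
    moreover have "sin (x / 2) \<noteq> 0"
    proof
      assume "sin (x / 2) = 0"
      then obtain i where "x / 2 = of_int i * pi" by (auto simp: sin_zero_iff_int2)
      hence "pi * real_of_int j = pi * (real_of_int i * (2 * real N - 1))"
        using M by (simp add: x_def field_simps)
      hence "real_of_int j = real_of_int i * (2 * real N - 1)" by simp
      hence "real_of_int j = real_of_int (i * (2 * int N - 1))" by simp
      hence "j = i * (2 * int N - 1)" by (simp only: of_int_eq_iff)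
      hence "2 * int N - 1 dvd j" by simp
      with False have "\<bar>2 * int N - 1\<bar> \<le> \<bar>j\<bar>" by (rule dvd_imp_le_int)
      with j show False by linarith
    qed
    ultimately show ?thesis using False by simp
  qed
  finally show ?thesis .
qed

text \<open>
  The product formula reduces this to the frequencies \<open>k - l\<close> and \<open>k + l\<close>, both smaller than
  \<open>2N - 1\<close> in absolute value. For \<open>k = l = 0\<close> both contribute, which accounts for the factor
  \<open>1 / c\<^bsub>k\<^esub>\<close>.
\<close>

lemma cos_orthogonality:
  assumes k: "k \<in> {0..int N - 1}" and l: "l \<in> {0..int N - 1}"
  defines "\<psi> \<equiv> \<lambda>k q :: int. cos (2 * pi * real_of_int k * real_of_int q / (2 * real N - 1))"
  shows "(\<Sum>q=0..int N - 1. c_weight N q * \<psi> k q * \<psi> l q)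
       = (if k = l then ((2 * real N - 1) / 4) / c_weight N k else 0)"
proof -
  have N: "N \<ge> 1" using k by simp
  have "(\<Sum>q=0..int N - 1. c_weight N q * \<psi> k q * \<psi> l q)
     = (\<Sum>q=0..int N - 1. (c_weight N q * \<psi> (k - l) q + c_weight N q * \<psi> (k + l) q) / 2)"
    by (intro sum.cong refl)
      (simp add: \<psi>_def mult.assoc cos_times_cos algebra_simps add_divide_distrib diff_divide_distrib)
  also have "\<dots> = ((\<Sum>q=0..int N - 1. c_weight N q * \<psi> (k - l) q) + (\<Sum>q=0..int N - 1. c_weight N q * \<psi> (k + l) q)) / 2"
    by (simp add: sum.distrib sum_divide_distrib add_divide_distrib)
  also have "\<dots> = (if k = l then ((2 * real N - 1) / 4) / c_weight N k else 0)"
    unfolding \<psi>_def using k l N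
    by (subst (1 2) sum_c_weight_cos) (auto simp: c_weight_def)
  finally show ?thesis .
qed

definition dct_kernel :: "nat \<Rightarrow> int \<Rightarrow> int \<Rightarrow> real" where
  "dct_kernel N k r = cos (pi * real_of_int k * (2 * (real_of_int r + 1 / 2) / (2 * real N - 1)))"

text \<open>
  Counting the grid points from the right end replaces the odd multiples \<open>2r + 1\<close> by even ones,
  at the price of a sign \<open>(-1)\<^sup>k\<close>, written here as \<open>cos (\<pi>k)\<close>.
\<close>

lemma dct_kernel_reflect:
  assumes "N \<ge> 1"
  shows "dct_kernel N k (int N - 1 - q)
       = cos (pi * real_of_int k) * cos (2 * pi * real_of_int k * real_of_int q / (2 * real N - 1))"
proof -
  have M: "2 * real N - 1 > 0" using assms by simp
  have "pi * real_of_int k * (2 * (real_of_int (int N - 1 - q) + 1 / 2) / (2 * real N - 1))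
      = pi * real_of_int k - 2 * pi * real_of_int k * real_of_int q / (2 * real N - 1)"
    using M by (simp add: field_simps)
  thus ?thesis
    by (simp add: dct_kernel_def cos_diff)
qed

lemma cos_int_pi_square: "cos (pi * real_of_int k) * cos (pi * real_of_int k) = 1"
  using sin_cos_squared_add[of "pi * real_of_int k"]
  by (simp add: power2_eq_square)

lemma c_weight_reflect: "q \<in> {0..int N - 1} \<Longrightarrow> c_weight N (int N - 1 - q + 1) = c_weight N q"
  by (auto simp: c_weight_def)

lemma dct_orthogonality_rows:
  assumes k: "k \<in> {0..int N - 1}" and l: "l \<in> {0..int N - 1}"
  shows "(\<Sum>r=0..int N - 1. c_weight N (r + 1) * dct_kernel N k r * dct_kernel N l r)
       = (if k = l then ((2 * real N - 1) / 4) / c_weight N k else 0)"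
proof -
  have N: "N \<ge> 1" using k by simp
  let ?\<psi> = "\<lambda>k q :: int. cos (2 * pi * real_of_int k * real_of_int q / (2 * real N - 1))"
  let ?s = "cos (pi * real_of_int k) * cos (pi * real_of_int l)"
  have "(\<Sum>r=0..int N - 1. c_weight N (r + 1) * dct_kernel N k r * dct_kernel N l r)
      = (\<Sum>q=0..int N - 1. c_weight N (int N - 1 - q + 1) * dct_kernel N k (int N - 1 - q) * dct_kernel N l (int N - 1 - q))"
    by (rule sum.reindex_bij_witness[where i = "\<lambda>q. int N - 1 - q" and j = "\<lambda>r. int N - 1 - r"]) auto
  also have "\<dots> = (\<Sum>q=0..int N - 1. ?s * (c_weight N q * ?\<psi> k q * ?\<psi> l q))"
    by (intro sum.cong refl) (simp only: dct_kernel_reflect[OF N] c_weight_reflect mult_ac)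
  also have "\<dots> = ?s * (if k = l then ((2 * real N - 1) / 4) / c_weight N k else 0)"
    by (simp only: sum_distrib_left[symmetric] cos_orthogonality[OF k l])
  finally show ?thesis by (simp add: cos_int_pi_square)
qed

text \<open>
  With reflected grid indices the sign \<open>(-1)\<^sup>k\<close> occurs squared, and what remains is
  \<open>cos_orthogonality\<close> with \<open>k\<close> as the summation index.
\<close>

lemma dct_orthogonality_columns:
  assumes r: "r \<in> {0..int N - 1}" and s: "s \<in> {0..int N - 1}"
  shows "(\<Sum>k=0..int N - 1. c_weight N k * dct_kernel N k r * dct_kernel N k s)
       = (if r = s then ((2 * real N - 1) / 4) / c_weight N (r + 1) else 0)"
proof -
  have N: "N \<ge> 1" using r by simp
  define p q where "p = int N - 1 - r" and "q = int N - 1 - s"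
  have pq: "p \<in> {0..int N - 1}" "q \<in> {0..int N - 1}" using r s by (auto simp: p_def q_def)
  have rs: "r = int N - 1 - p" "s = int N - 1 - q" by (auto simp: p_def q_def)
  let ?\<psi> = "\<lambda>p k :: int. cos (2 * pi * real_of_int p * real_of_int k / (2 * real N - 1))"
  have "(\<Sum>k=0..int N - 1. c_weight N k * dct_kernel N k r * dct_kernel N k s)
      = (\<Sum>k=0..int N - 1. c_weight N k * ?\<psi> p k * ?\<psi> q k)"
  proof (intro sum.cong refl)
    fix k
    have "?\<psi> p k * ?\<psi> q k = (cos (pi * real_of_int k) * cos (pi * real_of_int k)) * (?\<psi> p k * ?\<psi> q k)"
      by (simp add: cos_int_pi_square)
    thus "c_weight N k * dct_kernel N k r * dct_kernel N k s = c_weight N k * ?\<psi> p k * ?\<psi> q k"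
      unfolding rs dct_kernel_reflect[OF N] by (simp add: mult_ac)
  qed
  also have "\<dots> = (if p = q then ((2 * real N - 1) / 4) / c_weight N p else 0)"
    by (rule cos_orthogonality[OF pq])
  also have "\<dots> = (if r = s then ((2 * real N - 1) / 4) / c_weight N (r + 1) else 0)"
    using c_weight_reflect[OF pq(1)] by (auto simp: rs)
  finally show ?thesis .
qed

section \<open>The grid\<close>

lemma D_plus_eq_dec_tuples: "D_plus n N = dec_tuples n {0..int N - 1}"
  by (simp add: D_plus_def D_set_def dec_tuples_def)

lemma grid_point_eq_iff:
  assumes N: "N \<ge> 1" and i: "i \<in> {1..n}" and j: "j \<in> {1..n}"
  shows "grid_point n N r i = grid_point n N s j \<longleftrightarrow> r i = s j"
proof -
  have "2 * real N - 1 \<noteq> 0" using N by simp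
  thus ?thesis using i j by (simp add: grid_point_def)
qed

lemma inj_on_grid_point:
  assumes "N \<ge> 1"
  shows "inj_on (grid_point n N) (D_plus n N)"
proof (rule inj_onI)
  fix r s assume "r \<in> D_plus n N" "s \<in> D_plus n N" and eq: "grid_point n N r = grid_point n N s"
  hence "r \<in> {1..n} \<rightarrow>\<^sub>E {0..int N - 1}" "s \<in> {1..n} \<rightarrow>\<^sub>E {0..int N - 1}"
    by (simp_all add: D_plus_def D_set_def)
  thus "r = s"
    by (rule PiE_ext) (use eq grid_point_eq_iff[OF assms] in metis)
qed

lemma grid_label_grid_point:
  assumes "N \<ge> 1" "r \<in> D_plus n N"
  shows "grid_label n N (grid_point n N r) = r"
  unfolding grid_label_def using assms inj_on_grid_point[OF assms(1), of n]
  by (intro the_equality) (auto dest: inj_onD)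

lemma stab_order_grid_point:
  assumes N: "N \<ge> 1"
  shows "stab_order n (grid_point n N r) = stab_order n r"
proof -
  have "grid_point n N r \<circ> \<sigma> = grid_point n N r \<longleftrightarrow> r \<circ> \<sigma> = r"
    if \<sigma>: "\<sigma> permutes {1..n}" for \<sigma>
  proof -
    have "grid_point n N r (\<sigma> i) = grid_point n N r i \<longleftrightarrow> r (\<sigma> i) = r i" for i
      using permutes_in_image[OF \<sigma>] permutes_not_in[OF \<sigma>]
      by (cases "i \<in> {1..n}") (auto simp: grid_point_eq_iff[OF N])
    thus ?thesis by (simp add: fun_eq_iff)
  qed
  thus ?thesis by (simp add: stab_order_def cong: conj_cong)
qed

lemma cos_plus_grid_point:
  "cos_plus n (\<lambda>i. real_of_int (k i)) (grid_point n N r) = sym_kernel n (dct_kernel N) k r"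
  unfolding cos_plus_def sym_kernel_def dct_kernel_def
  by (intro sum.cong prod.cong refl) (simp add: grid_point_def)

lemma sum_F_plus:
  assumes "N \<ge> 1"
  shows "(\<Sum>s\<in>F_plus n N. h s) = (\<Sum>r\<in>D_plus n N. h (grid_point n N r))"
  unfolding F_plus_def by (simp add: sum.reindex[OF inj_on_grid_point[OF assms]])

lemma eps_weight_grid_point:
  assumes "N \<ge> 1" "r \<in> D_plus n N"
  shows "eps_weight n N (grid_point n N r) = (\<Prod>i=1..n. c_weight N (r i + 1))"
  by (simp add: eps_weight_def grid_label_grid_point[OF assms])

section \<open>Orthogonality and expansion\<close>

theorem mainTheorem6:
  fixes n N :: nat
  assumes "n \<ge> 1" and "N \<ge> 1"
  shows "(\<forall>k\<in>D_plus n N. \<forall>k'\<in>D_plus n N.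
            (\<Sum>s\<in>F_plus n N. eps_weight n N s * inverse (real (stab_order n s)) *
               cos_plus n (\<lambda>i. real_of_int (k i)) s * cos_plus n (\<lambda>i. real_of_int (k' i)) s)
            = real (stab_order n k) / d_weight n N k * ((2 * real N - 1) / 4) ^ n *
              (if k = k' then 1 else 0))
       \<and> (\<forall>f :: (nat \<Rightarrow> real) \<Rightarrow> real. \<forall>s\<in>F_plus n N.
            f s = (\<Sum>k\<in>D_plus n N. smdct_coeff n N f k * cos_plus n (\<lambda>i. real_of_int (k i)) s))"
proof (intro conjI ballI allI)
  note N = assms(2)
  let ?I = "{0..int N - 1}"
  fix k k' assume k: "k \<in> D_plus n N" "k' \<in> D_plus n N"
  have "(\<Sum>s\<in>F_plus n N. eps_weight n N s * inverse (real (stab_order n s)) *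
               cos_plus n (\<lambda>i. real_of_int (k i)) s * cos_plus n (\<lambda>i. real_of_int (k' i)) s)
    = (\<Sum>r\<in>D_plus n N. (\<Prod>i=1..n. c_weight N (r i + 1)) * inverse (real (stab_order n r)) *
               sym_kernel n (dct_kernel N) k r * sym_kernel n (dct_kernel N) k' r)"
    by (simp add: sum_F_plus[OF N] eps_weight_grid_point[OF N] stab_order_grid_point[OF N]
        cos_plus_grid_point cong: sum.cong)
  also have "\<dots> = (if k = k' then real (stab_order n k) / (\<Prod>i=1..n. c_weight N (k i)) *
      ((2 * real N - 1) / 4) ^ n else 0)"
    unfolding D_plus_eq_dec_tuples
    by (rule symmetrized_orthogonality[where A = ?I and w = "\<lambda>r. c_weight N (r + 1)"])
      (use k dct_orthogonality_rows in \<open>auto simp: D_plus_eq_dec_tuples\<close>)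
  finally show "(\<Sum>s\<in>F_plus n N. eps_weight n N s * inverse (real (stab_order n s)) *
               cos_plus n (\<lambda>i. real_of_int (k i)) s * cos_plus n (\<lambda>i. real_of_int (k' i)) s)
            = real (stab_order n k) / d_weight n N k * ((2 * real N - 1) / 4) ^ n *
              (if k = k' then 1 else 0)"
    by (simp add: d_weight_def)
next
  note N = assms(2)
  let ?I = "{0..int N - 1}" and ?D = "D_plus n N"
  let ?M = "(2 * real N - 1) / 4"
  let ?\<epsilon> = "\<lambda>r. \<Prod>i=1..n. c_weight N (r i + 1)"
  let ?H = "\<lambda>r. real (stab_order n r)"
  let ?\<Phi> = "sym_kernel n (dct_kernel N)"
  fix f :: "(nat \<Rightarrow> real) \<Rightarrow> real" and s assume "s \<in> F_plus n N"
  then obtain t where t: "t \<in> ?D" and s: "s = grid_point n N t" by (auto simp: F_plus_def)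
  have Mnz: "?M ^ n \<noteq> 0" using N by simp
  have \<epsilon>nz: "?\<epsilon> t \<noteq> 0" by (simp add: c_weight_def)
  have Hnz: "?H r \<noteq> 0" for r :: "nat \<Rightarrow> int" using stab_order_pos[of n r] by simp
  have finD: "finite ?D" by (simp add: D_plus_eq_dec_tuples finite_dec_tuples)
  have dual: "(\<Sum>k\<in>?D. d_weight n N k * inverse (?H k) * ?\<Phi> k r * ?\<Phi> k t)
      = (if r = t then ?H t / ?\<epsilon> t * ?M ^ n else 0)" if r: "r \<in> ?D" for r
    unfolding D_plus_eq_dec_tuples d_weight_def sym_kernel_flip[of n "dct_kernel N"]
    by (subst symmetrized_orthogonality[where A = ?I and v = "\<lambda>r. c_weight N (r + 1)" and C = ?M])
      (use r t dct_orthogonality_columns in \<open>auto simp: D_plus_eq_dec_tuples\<close>)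
  have coeff: "smdct_coeff n N f k = d_weight n N k * inverse (?H k) * inverse (?M ^ n) *
      (\<Sum>r\<in>?D. ?\<epsilon> r * inverse (?H r) * f (grid_point n N r) * ?\<Phi> k r)" for k
  proof -
    have "(4 / (2 * real N - 1)) ^ n = inverse (?M ^ n)" by (simp add: power_divide)
    moreover have "(\<Sum>s\<in>F_plus n N. eps_weight n N s * inverse (real (stab_order n s)) * f s *
          cos_plus n (\<lambda>i. real_of_int (k i)) s)
        = (\<Sum>r\<in>?D. ?\<epsilon> r * inverse (?H r) * f (grid_point n N r) * ?\<Phi> k r)"
      by (simp add: sum_F_plus[OF N] eps_weight_grid_point[OF N] stab_order_grid_point[OF N]
          cos_plus_grid_point cong: sum.cong)
    ultimately show ?thesis by (simp only: smdct_coeff_def divide_inverse[of "d_weight n N k"])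
  qed
  have "(\<Sum>k\<in>?D. smdct_coeff n N f k * cos_plus n (\<lambda>i. real_of_int (k i)) s)
      = (\<Sum>k\<in>?D. \<Sum>r\<in>?D. ?\<epsilon> r * inverse (?H r) * f (grid_point n N r) * inverse (?M ^ n) *
          (d_weight n N k * inverse (?H k) * ?\<Phi> k r * ?\<Phi> k t))"
    unfolding coeff s cos_plus_grid_point sum_distrib_left sum_distrib_right
    by (intro sum.cong refl) (simp only: mult_ac)
  also have "\<dots> = (\<Sum>r\<in>?D. \<Sum>k\<in>?D. ?\<epsilon> r * inverse (?H r) * f (grid_point n N r) * inverse (?M ^ n) *
          (d_weight n N k * inverse (?H k) * ?\<Phi> k r * ?\<Phi> k t))"
    by (rule sum.swap)
  also have "\<dots> = (\<Sum>r\<in>?D. if r = t then ?\<epsilon> t * inverse (?H t) * f s * inverse (?M ^ n) *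
          (?H t / ?\<epsilon> t * ?M ^ n) else 0)"
    unfolding sum_distrib_left[symmetric]
    by (intro sum.cong refl) (simp only: dual s, simp)
  also have "\<dots> = ?\<epsilon> t * inverse (?H t) * f s * inverse (?M ^ n) * (?H t / ?\<epsilon> t * ?M ^ n)"
    using finD t by simp
  also have "\<dots> = f s"
    using Mnz \<epsilon>nz Hnz[of t] by (simp only: divide_inverse) (simp add: field_simps)
  finally show "f s = (\<Sum>k\<in>?D. smdct_coeff n N f k * cos_plus n (\<lambda>i. real_of_int (k i)) s)" ..
qed

end
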